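(* Let $k$ be a nonzero integer. Then the generalized Bernoulli numbers $B_n^{(k)}$ and the Bernoulli numbers $B_n$ satisfy $$\sum_{i=0}^{n}\binom{n}{i}B_{i}B_{n-i}^{(k)}=\left(1-\frac{n}{k}\right)B_{n}^{(k)}-nB_{n-1}^{(k)}\quad\text{for all } n\geq 0,$$ or, equivalently, $$\sum_{i=2}^{n-2}\binom{n}{i}B_{i}B_{n-i}^{(k)}=-\frac{n}{k}B_{n}^{(k)}-\frac{1}{2}nB_{n-1}^{(k)}+\frac{1}{2}knB_{n-1}-B_{n}\quad\text{for all } n\geq 4.$$
   Context: For any integer $m$, the generalized Bernoulli numbers $B_n^{(m)}$ are defined by the formal power series identity $\left(1+\sum_{n\geq 1}\frac{1}{(n+1)!}X^{n}\right)^{-m}=1+\sum_{n\geq 1}\frac{1}{n!}B_{n}^{(m)}X^{n}$, with $B_0^{(m)}=1$; the Bernoulli numbers are $B_n=B_n^{(1)}$ (so $B_0=1$, $B_1=-\tfrac12$). For $n=0$ the term $nB_{n-1}^{(k)}$ is understood to be $0$. *)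

theory Defs
  imports "HOL-Computational_Algebra.Computational_Algebra"
begin

definition exp_quotient_fps :: "rat fps" where
  "exp_quotient_fps = Abs_fps (\<lambda>n. 1 / fact (n + 1))"

text \<open>
  The base series has constant term \<open>1\<close>, hence it is invertible and \<open>powi\<close> is the
  genuine integer power in the ring of formal power series, also for negative exponents.
\<close>

definition gen_bernoulli :: "int \<Rightarrow> nat \<Rightarrow> rat" where
  "gen_bernoulli m n = fact n * fps_nth (exp_quotient_fps powi (- m)) n"

abbreviation bernoulli :: "nat \<Rightarrow> rat" where
  "bernoulli \<equiv> gen_bernoulli 1"

lemma exp_quotient_fps_alt:
  "fps_X * exp_quotient_fps = fps_exp 1 - 1"
  by (rule fps_ext) (auto simp: exp_quotient_fps_def fps_X_mult_nth fact_reduce field_simps)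

lemma exp_quotient_fps_nth_0 [simp]: "fps_nth exp_quotient_fps 0 = 1"
  by (simp add: exp_quotient_fps_def)

lemma gen_bernoulli_egf:
  "Abs_fps (\<lambda>n. gen_bernoulli m n / fact n) = exp_quotient_fps powi (- m)"
  by (rule fps_ext) (simp add: gen_bernoulli_def)

lemma gen_bernoulli_0 [simp]: "gen_bernoulli m 0 = 1"
  by (simp add: gen_bernoulli_def power_int_def fps_nth_power_0)

lemma bernoulli_1: "bernoulli 1 = - 1 / 2"
  by (simp add: gen_bernoulli_def power_int_def fps_inverse_def exp_quotient_fps_def)

end

theory Submission
  imports Defs
begin

text \<open>
  Write \<open>E = (e\<^sup>X - 1) / X\<close>, so that \<open>E\<^sup>-\<^sup>k\<close> is the exponential generating function of the
  generalized Bernoulli numbers and \<open>E\<^sup>-\<^sup>1\<close> that of the ordinary ones. Differentiating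
  \<open>X E = e\<^sup>X - 1\<close> gives the differential equation \<open>X E' = 1 + X E - E\<close>. Substituting it into the
  power rule for \<open>F = E\<^sup>-\<^sup>k\<close> turns the derivative into a product of generating functions,
  \<open>X F' = k (F - X F - E\<^sup>-\<^sup>1 F)\<close>, and the first identity is the comparison of coefficients of
  \<open>X\<^sup>n\<close>. Its case \<open>n = 1\<close> yields \<open>B\<^sub>1\<^sup>(\<^sup>k\<^sup>) = - k / 2\<close>; the second identity arises by moving
  the terms for the indices \<open>0\<close>, \<open>1\<close>, \<open>n - 1\<close> and \<open>n\<close> to the other side.
\<close>

lemma X_mult_deriv_exp_quotient_fps:
  "fps_X * fps_deriv exp_quotient_fps = 1 + fps_X * exp_quotient_fps - exp_quotient_fps"
proof -
  have "exp_quotient_fps + fps_X * fps_deriv exp_quotient_fps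
          = fps_deriv (fps_X * exp_quotient_fps)"
    by simp
  also have "\<dots> = 1 + fps_X * exp_quotient_fps"
    by (simp add: exp_quotient_fps_alt)
  finally show ?thesis
    by (simp add: algebra_simps)
qed

text \<open>
  Multiplying the power rule by the base keeps the exponent \<open>m\<close> on both sides, which avoids
  laws for integer exponents that differ by one; formal power series are not a division ring.
  For negative \<open>m\<close> the rule for natural exponents, applied to \<open>f\<^sup>-\<^sup>1\<close>, is combined with
  \<open>(f\<^sup>-\<^sup>1)' = - f' f\<^sup>-\<^sup>2\<close>.
\<close>

lemma fps_deriv_power_int_mult:
  fixes f :: "'a::field fps"
  assumes "fps_nth f 0 \<noteq> 0"
  shows "fps_deriv (f powi m) * f = of_int m * fps_deriv f * f powi m"
proof -
  have nat_power_rule: "fps_deriv (g ^ j) * g = of_nat j * fps_deriv g * g ^ j"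
    for g :: "'a fps" and j
  proof (cases j)
    case (Suc i)
    show ?thesis
      unfolding Suc fps_deriv_power' by (simp add: algebra_simps)
  qed simp
  show ?thesis
  proof (cases "m \<ge> 0")
    case True
    thus ?thesis
      using nat_power_rule[of f "nat m"] by (simp add: power_int_def)
  next
    case False
    define g where "g = inverse f"
    define j where "j = nat (- m)"
    have m: "m = - int j" and powi: "f powi m = g ^ j"
      using False by (simp_all add: j_def g_def power_int_def)
    have gf: "g * f = 1"
      using assms by (simp add: g_def inverse_mult_eq_1)
    have dg: "fps_deriv g = - fps_deriv f * g\<^sup>2"
      using assms by (simp add: g_def fps_inverse_deriv)
    have "fps_deriv (g ^ j) * f = fps_deriv (g ^ j) * g * f\<^sup>2"
      using gf by (simp add: power2_eq_square mult.assoc)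
    also have "\<dots> = of_nat j * (- fps_deriv f) * g ^ j * (g * f)\<^sup>2"
      unfolding nat_power_rule dg by (simp add: power_mult_distrib mult_ac)
    finally show ?thesis
      unfolding powi by (simp add: m gf)
  qed
qed

text \<open>
  The power rule produces the factor \<open>X E' E\<^sup>-\<^sup>1 = E\<^sup>-\<^sup>1 + X - 1\<close>. Its summand \<open>E\<^sup>-\<^sup>1\<close>
  is the generating function of the Bernoulli numbers, and this is where their convolution with the
  generalized ones comes from.
\<close>

lemma gen_bernoulli_egf_ode:
  defines "E \<equiv> exp_quotient_fps"
  shows "fps_X * fps_deriv (E powi (- k))
           = of_int k * (E powi (- k) - fps_X * E powi (- k) - E powi (- 1) * E powi (- k))"
proof -
  define F where "F = E powi (- k)"
  define G where "G = E powi (- 1)"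
  have EG: "E * G = 1"
    by (simp add: E_def G_def power_int_def inverse_mult_eq_1')
  have power_rule: "fps_deriv F * E = - of_int k * fps_deriv E * F"
    using fps_deriv_power_int_mult[of E "- k"] by (simp add: F_def E_def)
  have "fps_X * fps_deriv F = fps_X * (fps_deriv F * E) * G"
    by (metis EG mult.assoc mult.right_neutral)
  also have "\<dots> = - of_int k * (fps_X * fps_deriv E) * F * G"
    unfolding power_rule by (simp add: mult_ac)
  also have "\<dots> = - of_int k * (G + fps_X * (E * G) - E * G) * F"
    unfolding E_def X_mult_deriv_exp_quotient_fps by (simp add: algebra_simps)
  also have "\<dots> = of_int k * (F - fps_X * F - G * F)"
    by (simp add: EG algebra_simps)
  finally show ?thesis
    by (simp add: F_def G_def)
qed

lemma fps_nth_power_int_exp_quotient: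
  "fps_nth (exp_quotient_fps powi (- m)) n = gen_bernoulli m n / fact n"
  by (simp add: gen_bernoulli_def)

text \<open>
  Coefficients of \<open>X\<^sup>n / n!\<close> in the preceding equation: the product becomes a binomial
  convolution, multiplication by \<open>X\<close> becomes an index shift weighted by \<open>n\<close>, and the Euler
  operator \<open>X d/dX\<close> becomes multiplication by \<open>n\<close>.
\<close>

lemma bernoulli_convolution:
  assumes "k \<noteq> 0"
  shows "(\<Sum>i=0..n. of_nat (n choose i) * bernoulli i * gen_bernoulli k (n - i))
           = (1 - of_nat n / of_int k) * gen_bernoulli k n - of_nat n * gen_bernoulli k (n - 1)"
    (is "?S = _")
proof -
  define E where "E = exp_quotient_fps"
  have conv: "fps_nth (E powi (- 1) * E powi (- k)) n = ?S / fact n"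
    unfolding E_def fps_mult_nth fps_nth_power_int_exp_quotient sum_divide_distrib
    by (intro sum.cong) (simp_all add: binomial_fact field_simps)
  have shift: "fps_nth (fps_X * E powi (- k)) n = of_nat n * gen_bernoulli k (n - 1) / fact n"
    unfolding E_def fps_X_mult_nth fps_nth_power_int_exp_quotient
    by (cases n) (simp_all del: of_nat_Suc)
  have euler: "fps_nth (fps_X * fps_deriv (E powi (- k))) n
                 = of_nat n * gen_bernoulli k n / fact n"
    unfolding E_def fps_X_mult_nth fps_deriv_nth fps_nth_power_int_exp_quotient
    by (cases n) simp_all
  have "fps_nth (fps_X * fps_deriv (E powi (- k))) n
          = of_int k * (fps_nth (E powi (- k)) n - fps_nth (fps_X * E powi (- k)) n
              - fps_nth (E powi (- 1) * E powi (- k)) n)"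
    unfolding E_def gen_bernoulli_egf_ode by (simp add: fps_of_int[symmetric])
  hence "of_nat n * gen_bernoulli k n / fact n
           = of_int k * (gen_bernoulli k n - of_nat n * gen_bernoulli k (n - 1) - ?S) / fact n"
    unfolding conv shift euler
    by (simp add: E_def fps_nth_power_int_exp_quotient diff_divide_distrib right_diff_distrib)
  hence "of_nat n * gen_bernoulli k n
           = of_int k * (gen_bernoulli k n - of_nat n * gen_bernoulli k (n - 1) - ?S)"
    by simp
  with assms show ?thesis
    by (simp add: field_simps)
qed

lemma gen_bernoulli_1:
  assumes "k \<noteq> 0"
  shows "gen_bernoulli k 1 = - of_int k / 2"
proof -
  have "gen_bernoulli k 1 + bernoulli 1 = (1 - 1 / of_int k) * gen_bernoulli k 1 - 1"
    using bernoulli_convolution[OF assms, of 1] by simp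
  with assms show ?thesis
    unfolding bernoulli_1 by (simp add: field_simps)
qed

theorem theorem2p14:
  fixes k :: int
  assumes "k \<noteq> 0"
  shows "(\<forall>n::nat.
            (\<Sum>i=0..n. of_nat (n choose i) * bernoulli i * gen_bernoulli k (n - i))
              = (1 - of_nat n / of_int k) * gen_bernoulli k n
                - of_nat n * gen_bernoulli k (n - 1))
       \<and> (\<forall>n::nat. n \<ge> 4 \<longrightarrow>
            (\<Sum>i=2..n - 2. of_nat (n choose i) * bernoulli i * gen_bernoulli k (n - i))
              = - (of_nat n / of_int k) * gen_bernoulli k n
                - 1 / 2 * of_nat n * gen_bernoulli k (n - 1)
                + 1 / 2 * of_int k * of_nat n * bernoulli (n - 1)
                - bernoulli n)"
proof (intro conjI allI impI)
  fix n :: nat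
  show "(\<Sum>i=0..n. of_nat (n choose i) * bernoulli i * gen_bernoulli k (n - i))
          = (1 - of_nat n / of_int k) * gen_bernoulli k n - of_nat n * gen_bernoulli k (n - 1)"
    by (rule bernoulli_convolution[OF assms])
next
  fix n :: nat
  assume n: "n \<ge> 4"
  define t where "t i = of_nat (n choose i) * bernoulli i * gen_bernoulli k (n - i)" for i
  \<comment> \<open>For \<open>n \<ge> 4\<close> the four indices that are split off are distinct.\<close>
  have "{0..n} = {0, 1, n - 1, n} \<union> {2..n - 2}"
    using n by auto
  moreover have "n - 1 \<notin> insert n {2..n - 2}" "n \<notin> {2..n - 2}"
    using n by auto
  ultimately have "sum t {0..n} = t 0 + t 1 + t (n - 1) + t n + sum t {2..n - 2}"
    using n by (simp add: add.assoc)
  moreover have "t 0 = gen_bernoulli k n" "t n = bernoulli n"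
    by (simp_all add: t_def)
  moreover have "t 1 = - 1 / 2 * of_nat n * gen_bernoulli k (n - 1)"
    using bernoulli_1 by (simp add: t_def)
  moreover have "t (n - 1) = - 1 / 2 * of_int k * of_nat n * bernoulli (n - 1)"
    using n gen_bernoulli_1[OF assms] binomial_symmetric[of 1 n] by (simp add: t_def)
  moreover have "sum t {0..n}
      = (1 - of_nat n / of_int k) * gen_bernoulli k n - of_nat n * gen_bernoulli k (n - 1)"
    unfolding t_def by (rule bernoulli_convolution[OF assms])
  ultimately have "sum t {2..n - 2}
              = - (of_nat n / of_int k) * gen_bernoulli k n
                - 1 / 2 * of_nat n * gen_bernoulli k (n - 1)
                + 1 / 2 * of_int k * of_nat n * bernoulli (n - 1)
                - bernoulli n"
    by (simp add: algebra_simps)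
  thus "(\<Sum>i=2..n - 2. of_nat (n choose i) * bernoulli i * gen_bernoulli k (n - i))
              = - (of_nat n / of_int k) * gen_bernoulli k n
                - 1 / 2 * of_nat n * gen_bernoulli k (n - 1)
                + 1 / 2 * of_int k * of_nat n * bernoulli (n - 1)
                - bernoulli n"
    by (simp add: t_def)
qed

end
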